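(* There is an absolute constant $c>0$ such that for every finite set $A \subset \mathbb{R}$ with $|A|\ge 2$, there exist elements $a,a' \in A$ such that $$|(A-a)(A-a')| \geq c\,\frac{|A|^2}{\log |A|},$$ where $(A-a)(A-a') = \{(x-a)(y-a') : x,y \in A\}$.
   Context: The paper writes $X \gg Y$ for $X \ge cY$ with an absolute constant $c>0$; the claim expresses the paper's bound $|(A-a)(A-a')| \gg |A|^2/\log|A|$ in this form. *)

theory Defs
  imports Complex_Main
begin

definition shifted_product_set :: "real set \<Rightarrow> real \<Rightarrow> real \<Rightarrow> real set" where
  "shifted_product_set A a a' = {(x - a) * (y - a') | x y. x \<in> A \<and> y \<in> A}"

end

theory Submission
  imports Defs "HOL-Analysis.Convex"
begin

text \<open>
  The sum over \<open>(a, a') \<in> A \<times> A\<close> of the multiplicative energies of \<open>A - a\<close> and \<open>A - a'\<close> counts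
  collinear triples in the grid \<open>A \<times> A\<close>: the equation \<open>(x - a)(y - a') = (x' - a)(y' - a')\<close> says
  that \<open>(a, a')\<close>, \<open>(x, y')\<close>, \<open>(x', y)\<close> lie on one line. With \<open>n = |A|\<close>, this count is
  \<open>O(n\<^sup>4 log n)\<close>, because only \<open>O(n\<^sup>4 / k\<^sup>3)\<close> lines contain at least \<open>k\<close> grid points; averaging over
  \<open>(a, a')\<close> and the Cauchy-Schwarz inequality then give the theorem.

  For a grid the bound on \<open>k\<close>-rich lines is elementary. Cut \<open>A\<close> into about \<open>k/4\<close> blocks of
  consecutive elements. A line, being monotone, meets at most about \<open>k/2\<close> of the resulting
  cells, so a \<open>k\<close>-rich line contains at least about \<open>k/2\<close> pairs of points sharing a cell. Each
  pair determines the line, and there are only \<open>O(n\<^sup>4 / k\<^sup>2)\<close> pairs sharing a cell.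
\<close>

section \<open>Blocks of consecutive elements\<close>

definition rank :: "'a::linorder set \<Rightarrow> 'a \<Rightarrow> nat" where
  "rank A x = card {z \<in> A. z < x}"

text \<open>Cutting by rank rather than by value keeps each block at \<open>d\<close> elements or
  fewer, however unevenly \<open>A\<close> is spaced.\<close>

definition block :: "'a::linorder set \<Rightarrow> nat \<Rightarrow> 'a \<Rightarrow> nat" where
  "block A d x = rank A x div d"

lemma rank_less_card:
  assumes "finite A" "x \<in> A"
  shows "rank A x < card A"
  unfolding rank_def using assms by (intro psubset_card_mono) auto

lemma rank_mono:
  assumes "finite A" "x \<le> y"
  shows "rank A x \<le> rank A y"
  unfolding rank_def using assms by (intro card_mono) auto

lemma rank_strict_mono:
  assumes "finite A" "x \<in> A" "x < y"
  shows "rank A x < rank A y"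
  unfolding rank_def using assms by (intro psubset_card_mono) auto

lemma inj_on_rank:
  assumes "finite A"
  shows "inj_on (rank A) A"
  using rank_strict_mono[OF assms] by (intro linorder_inj_onI') (metis less_irrefl)

lemma block_mono:
  assumes "finite A" "x \<le> y"
  shows "block A d x \<le> block A d y"
  unfolding block_def using rank_mono[OF assms] by (rule div_le_mono)

lemma block_le:
  assumes "finite A" "x \<in> A"
  shows "block A d x \<le> (card A - 1) div d"
  unfolding block_def using rank_less_card[OF assms] by (intro div_le_mono) simp

lemma card_block_le:
  assumes "finite A" "d > 0"
  shows "card {x \<in> A. block A d x = q} \<le> d"
proof -
  have "card {x \<in> A. block A d x = q} \<le> card {q * d..<q * d + d}"
  proof (rule card_inj_on_le)
    show "inj_on (rank A) {x \<in> A. block A d x = q}"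
      by (rule inj_on_subset[OF inj_on_rank[OF assms(1)]]) auto
    show "rank A ` {x \<in> A. block A d x = q} \<subseteq> {q * d..<q * d + d}"
      using assms(2) dividend_less_div_times[of d] by (auto simp: block_def add.commute)
  qed simp
  then show ?thesis by simp
qed

section \<open>Collisions of a function\<close>

lemma card_le_card_image_plus_collisions:
  assumes "finite S"
  shows "card S \<le> card (f ` S) + card {(x, y) \<in> S \<times> S. x \<noteq> y \<and> f x = f y}"
proof -
  define r where "r x = inv_into S f (f x)" for x
  define C where "C = {(x, y) \<in> S \<times> S. x \<noteq> y \<and> f x = f y}"
  have r: "r x \<in> S" "f (r x) = f x" if "x \<in> S" for x
    unfolding r_def using that by (auto intro: inv_into_into f_inv_into_f)
  have "finite C"
    unfolding C_def by (rule finite_subset[of _ "S \<times> S"]) (use assms in auto)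
  have "card S \<le> card (inv_into S f ` f ` S \<union> fst ` C)"
  proof (rule card_mono)
    show "finite (inv_into S f ` f ` S \<union> fst ` C)"
      using assms \<open>finite C\<close> by simp
    show "S \<subseteq> inv_into S f ` f ` S \<union> fst ` C"
    proof
      fix x assume "x \<in> S"
      show "x \<in> inv_into S f ` f ` S \<union> fst ` C"
      proof (cases "r x = x")
        case True
        then show ?thesis using \<open>x \<in> S\<close> unfolding r_def by force
      next
        case False
        then have "(x, r x) \<in> C" using r \<open>x \<in> S\<close> by (auto simp: C_def)
        then show ?thesis by force
      qed
    qed
  qed
  also have "\<dots> \<le> card (inv_into S f ` f ` S) + card (fst ` C)"
    by (rule card_Un_le)
  also have "\<dots> \<le> card (f ` S) + card C"
    using assms \<open>finite C\<close> by (intro add_mono card_image_le) auto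
  finally show ?thesis by (simp add: C_def)
qed

text \<open>Cauchy-Schwarz applied to the fibre sizes: these sum to \<open>card S\<close>, and their
  squares sum to the number of pairs with equal values.\<close>

lemma card_power2_le_card_image_times_energy:
  assumes "finite S"
  shows "(card S)\<^sup>2 \<le> card (f ` S) * card {(x, y) \<in> S \<times> S. f x = f y}"
proof -
  define F where "F v = {x \<in> S. f x = v}" for v
  have fin: "finite (F v)" for v using assms by (simp add: F_def)
  have S: "card S = (\<Sum>v\<in>f ` S. card (F v))"
    using sum.image_gen[OF assms, of "\<lambda>_. 1 :: nat" f] by (simp add: F_def)
  have "{(x, y) \<in> S \<times> S. f x = f y} = (\<Union>v\<in>f ` S. F v \<times> F v)"
    by (auto simp: F_def)
  moreover have "card (\<Union>v\<in>f ` S. F v \<times> F v) = (\<Sum>v\<in>f ` S. card (F v \<times> F v))"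
    using assms fin by (intro card_UN_disjoint) (auto simp: F_def)
  ultimately have E: "card {(x, y) \<in> S \<times> S. f x = f y} = (\<Sum>v\<in>f ` S. (card (F v))\<^sup>2)"
    by (simp add: card_cartesian_product power2_eq_square)
  have "real ((card S)\<^sup>2) \<le> real (card (f ` S) * card {(x, y) \<in> S \<times> S. f x = f y})"
    using Cauchy_Schwarz_ineq_sum[of "\<lambda>_. 1" "\<lambda>v. real (card (F v))" "f ` S"]
    unfolding S E by simp
  then show ?thesis by (simp only: of_nat_le_iff)
qed

section \<open>Rich lines in a grid\<close>

text \<open>The pair \<open>l = (s, b)\<close> stands for the line \<open>y = s x + b\<close>.\<close>

definition line_trace :: "real set \<Rightarrow> real \<times> real \<Rightarrow> real set" where
  "line_trace A l = {x \<in> A. fst l * x + snd l \<in> A}"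

definition rich_lines :: "real set \<Rightarrow> nat \<Rightarrow> (real \<times> real) set" where
  "rich_lines A k = {l. fst l \<noteq> 0 \<and> k \<le> card (line_trace A l)}"

text \<open>The pairs are ordered and keep abscissae only, because the line supplies the
  ordinates.\<close>

definition cell_pairs :: "real set \<Rightarrow> nat \<Rightarrow> real \<times> real \<Rightarrow> (real \<times> real) set" where
  "cell_pairs A d l = {(x, x') \<in> line_trace A l \<times> line_trace A l. x \<noteq> x' \<and>
     block A d x = block A d x' \<and>
     block A d (fst l * x + snd l) = block A d (fst l * x' + snd l)}"

lemma finite_line_trace: "finite A \<Longrightarrow> finite (line_trace A l)"
  by (simp add: line_trace_def)

lemma card_line_trace_le: "finite A \<Longrightarrow> card (line_trace A l) \<le> card A"
  by (auto simp: line_trace_def intro: card_mono)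

lemma finite_cell_pairs: "finite A \<Longrightarrow> finite (cell_pairs A d l)"
  unfolding cell_pairs_def
  by (rule finite_subset[of _ "line_trace A l \<times> line_trace A l"]) (auto simp: finite_line_trace)

text \<open>Block indices run from 0 to \<open>(card A - 1) div d\<close>, so a monotone line visits
  at most \<open>2 * ((card A - 1) div d) + 1\<close> cells. Every point beyond one per cell
  contributes a pair.\<close>

lemma card_line_trace_le_cell_pairs:
  assumes "finite A" "fst l \<noteq> 0"
  shows "card (line_trace A l) \<le> 2 * ((card A - 1) div d) + 1 + card (cell_pairs A d l)"
proof -
  define q where "q = (card A - 1) div d"
  define S where "S = line_trace A l"
  \<comment> \<open>Integers rather than naturals: for negative slope the invariant is the
    difference \<open>f x - g x\<close>, which may be negative.\<close>
  define f where "f x = int (block A d x)" for x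
  define g where "g x = int (block A d (fst l * x + snd l))" for x
  have "finite S" using assms(1) by (simp add: S_def finite_line_trace)
  have f_range: "0 \<le> f x" "f x \<le> int q" and g_range: "0 \<le> g x" "g x \<le> int q" if "x \<in> S" for x
    using that block_le[OF assms(1), of _ d]
    by (auto simp: f_def g_def q_def S_def line_trace_def simp del: of_nat_div)
  \<comment> \<open>Along a line both block indices are monotone, so their sum or difference,
    according to the sign of the slope, determines the cell.\<close>
  obtain h :: "real \<Rightarrow> int" and I where h: "h ` S \<subseteq> I" "finite I" "card I = 2 * q + 1"
    "\<And>x x'. x \<in> S \<Longrightarrow> x' \<in> S \<Longrightarrow> h x = h x' \<Longrightarrow> f x = f x' \<and> g x = g x'"
  proof (cases "fst l > 0")
    case True
    have mono: "f x \<le> f x' \<and> g x \<le> g x'" if "x \<le> x'" for x x'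
      using that True by (auto simp: f_def g_def intro!: block_mono assms)
    show thesis
    proof (rule that[of "\<lambda>x. f x + g x" "{0..2 * int q}"])
      show "(\<lambda>x. f x + g x) ` S \<subseteq> {0..2 * int q}"
        using f_range g_range by fastforce
      show "f x = f x' \<and> g x = g x'" if "f x + g x = f x' + g x'" for x x'
        using mono[of x x'] mono[of x' x] that by linarith
    qed auto
  next
    case False
    then have neg: "fst l < 0" using assms(2) by simp
    have mono: "f x \<le> f x' \<and> g x' \<le> g x" if "x \<le> x'" for x x'
      using that neg by (auto simp: f_def g_def intro!: block_mono assms)
    show thesis
    proof (rule that[of "\<lambda>x. f x - g x" "{- int q..int q}"])
      show "(\<lambda>x. f x - g x) ` S \<subseteq> {- int q..int q}"
        using f_range g_range by fastforce
      show "f x = f x' \<and> g x = g x'" if "f x - g x = f x' - g x'" for x x'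
        using mono[of x x'] mono[of x' x] that by linarith
    qed auto
  qed
  have "card S \<le> card (h ` S) + card {(x, y) \<in> S \<times> S. x \<noteq> y \<and> h x = h y}"
    by (rule card_le_card_image_plus_collisions) fact
  also have "card (h ` S) \<le> 2 * q + 1"
    using card_mono[OF h(2,1)] h(3) by simp
  also have "card {(x, y) \<in> S \<times> S. x \<noteq> y \<and> h x = h y} \<le> card (cell_pairs A d l)"
  proof (rule card_mono)
    show "{(x, y) \<in> S \<times> S. x \<noteq> y \<and> h x = h y} \<subseteq> cell_pairs A d l"
      using h(4) by (auto simp: cell_pairs_def S_def f_def g_def)
  qed (simp add: finite_cell_pairs assms)
  finally show ?thesis by (simp add: S_def q_def)
qed

lemma line_through_two_points_unique:
  fixes s b s' b' x x' :: real
  assumes "s * x + b = s' * x + b'" "s * x' + b = s' * x' + b'" "x \<noteq> x'"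
  shows "s = s' \<and> b = b'"
proof -
  have "(s - s') * (x - x') = 0" using assms(1,2) by (simp add: algebra_simps)
  then show ?thesis using assms by simp
qed

text \<open>Two distinct points determine the line, so different lines yield different pairs of grid
  points. The first point has \<open>(card A)\<^sup>2\<close> choices, and then the second, in the
  same cell, has at most \<open>d\<^sup>2\<close>.\<close>

lemma sum_card_cell_pairs_le:
  assumes "finite A" "d > 0" "finite L"
  shows "(\<Sum>l\<in>L. card (cell_pairs A d l)) \<le> (card A)\<^sup>2 * d\<^sup>2"
proof -
  define N where "N q = {x \<in> A. block A d x = q}" for q
  define Q where
    "Q = Sigma (A \<times> A) (\<lambda>p. N (block A d (fst p)) \<times> N (block A d (snd p)))"
  have N: "finite (N q)" "card (N q) \<le> d" for q
    using assms card_block_le by (auto simp: N_def)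
  have "(\<Sum>l\<in>L. card (cell_pairs A d l)) = card (Sigma L (cell_pairs A d))"
    using assms finite_cell_pairs by (subst card_SigmaI) auto
  also have "\<dots> \<le> card Q"
  proof (rule card_inj_on_le)
    let ?\<phi> = "\<lambda>((s, b), (x, x')). ((x, s * x + b), (x', s * x' + b :: real))"
    show "inj_on ?\<phi> (Sigma L (cell_pairs A d))"
      by (rule inj_onI) (auto simp: cell_pairs_def dest: line_through_two_points_unique)
    show "?\<phi> ` Sigma L (cell_pairs A d) \<subseteq> Q"
      by (auto simp: Q_def N_def cell_pairs_def line_trace_def)
    show "finite Q" using assms N by (auto simp: Q_def)
  qed
  also have "card Q \<le> (\<Sum>p\<in>A \<times> A. d\<^sup>2)"
    unfolding Q_def using assms N
    by (subst card_SigmaI) (auto simp: card_cartesian_product power2_eq_square simp del: sum_constant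
         intro!: sum_mono mult_mono)
  also have "\<dots> = (card A)\<^sup>2 * d\<^sup>2"
    by (simp add: card_cartesian_product power2_eq_square)
  finally show ?thesis .
qed

text \<open>Summing the bound for one line over \<open>L\<close>. A finite subset \<open>L\<close>
  is used because the finiteness of \<open>rich_lines A k\<close> is itself deduced from this
  inequality.\<close>

lemma card_subset_rich_lines:
  assumes "finite A" "d > 0" "finite L" "L \<subseteq> rich_lines A k"
  shows "card L * k \<le> card L * (2 * ((card A - 1) div d) + 1) + (card A)\<^sup>2 * d\<^sup>2"
proof -
  have "card L * k \<le> (\<Sum>l\<in>L. card (line_trace A l))"
    using assms(4) sum_bounded_below[of L k "\<lambda>l. card (line_trace A l)"]
    by (auto simp: rich_lines_def)
  also have "\<dots> \<le> (\<Sum>l\<in>L. 2 * ((card A - 1) div d) + 1 + card (cell_pairs A d l))"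
    using assms(4) card_line_trace_le_cell_pairs[OF assms(1)]
    by (intro sum_mono) (auto simp: rich_lines_def)
  also have "\<dots> = card L * (2 * ((card A - 1) div d) + 1) + (\<Sum>l\<in>L. card (cell_pairs A d l))"
    by (simp only: sum.distrib sum_constant of_nat_id distrib_left)
  also have "\<dots> \<le> card L * (2 * ((card A - 1) div d) + 1) + (card A)\<^sup>2 * d\<^sup>2"
    using sum_card_cell_pairs_le[OF assms(1-3)] by simp
  finally show ?thesis .
qed

text \<open>With \<open>d = card A\<close> there is a single block, so the inequality reads
  \<open>card L * 2 \<le> card L + card A ^ 4\<close>. This bound is uniform over finite
  \<open>L\<close>, which also gives finiteness.\<close>

lemma rich_lines_two:
  assumes "finite A" "A \<noteq> {}"
  shows "finite (rich_lines A 2) \<and> card (rich_lines A 2) \<le> card A ^ 4"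
proof (rule finite_if_finite_subsets_card_bdd)
  have pos: "card A > 0" using assms by (simp add: card_gt_0_iff)
  fix L assume "L \<subseteq> rich_lines A 2" "finite L"
  then show "card L \<le> card A ^ 4"
    using card_subset_rich_lines[OF assms(1) pos, of L 2] pos
    by (simp add: power4_eq_xxxx power2_eq_square mult.assoc)
qed

lemma rich_lines_antimono: "k \<le> m \<Longrightarrow> rich_lines A m \<subseteq> rich_lines A k"
  by (auto simp: rich_lines_def)

lemma finite_rich_lines:
  assumes "finite A" "A \<noteq> {}" "k \<ge> 2"
  shows "finite (rich_lines A k)"
  using rich_lines_two[OF assms(1,2)] rich_lines_antimono[OF assms(3)] by (meson finite_subset)

lemma card_rich_lines_le:
  assumes "finite A" "2 \<le> k" "k \<le> card A"
  shows "card (rich_lines A k) * k ^ 3 \<le> 100 * card A ^ 4"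
proof -
  define n where "n = card A"
  define M where "M = card (rich_lines A k)"
  have "A \<noteq> {}" "n > 0" "k \<le> n" using assms by (auto simp: n_def)
  show ?thesis
  proof (cases "k < 4")
    case True
    have "M \<le> card (rich_lines A 2)"
      unfolding M_def using rich_lines_two[OF assms(1) \<open>A \<noteq> {}\<close>] rich_lines_antimono[OF assms(2)]
      by (intro card_mono) auto
    also have "\<dots> \<le> n ^ 4"
      using rich_lines_two[OF assms(1) \<open>A \<noteq> {}\<close>] by (simp add: n_def)
    finally have "M * k ^ 3 \<le> n ^ 4 * 3 ^ 3"
      using True by (intro mult_mono power_mono) auto
    then show ?thesis by (simp add: M_def n_def)
  next
    case False
    \<comment> \<open>This is the least \<open>d\<close> with \<open>4 * n < d * k\<close>. The
      lower bound limits the number of cells on a line to about \<open>k / 2\<close>; the upper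
      bound \<open>d * k \<le> 5 * n\<close> keeps the cells small.\<close>
    define d where "d = 4 * n div k + 1"
    define q where "q = (n - 1) div d"
    have dk: "4 * n < d * k" "d * k \<le> 5 * n"
      unfolding d_def add_mult_distrib
      using False \<open>k \<le> n\<close> dividend_less_div_times[of k "4 * n"] div_times_less_eq_dividend[of "4 * n" k]
      by linarith+
    have "q * d \<le> n" unfolding q_def
      using div_times_less_eq_dividend[of "n - 1" d] by linarith
    have "q * (4 * n) \<le> q * (d * k)" using dk by (intro mult_left_mono) auto
    also have "\<dots> = (q * d) * k" by simp
    also have "\<dots> \<le> n * k" using \<open>q * d \<le> n\<close> by (rule mult_right_mono) simp
    finally have "4 * q \<le> k" using \<open>n > 0\<close> by (simp add: mult.commute mult.left_commute)
    have "M * k \<le> M * (2 * q + 1) + n\<^sup>2 * d\<^sup>2"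
      unfolding M_def n_def q_def
      using finite_rich_lines[OF assms(1) \<open>A \<noteq> {}\<close> assms(2)] assms(1)
      by (intro card_subset_rich_lines) (auto simp: d_def)
    \<comment> \<open>Here \<open>4 \<le> k\<close> absorbs the additive 4:
      \<open>8 * q + 4 \<le> 2 * k + 4 \<le> 3 * k\<close>. At least a quarter of
      \<open>M * k\<close> is thus left for the pairs.\<close>
    moreover have "M * (4 * (2 * q + 1)) \<le> M * (3 * k)"
      using \<open>4 * q \<le> k\<close> False by (intro mult_left_mono) auto
    ultimately have "M * k \<le> 4 * (n\<^sup>2 * d\<^sup>2)" by (simp add: algebra_simps)
    then have "M * k * k\<^sup>2 \<le> 4 * (n\<^sup>2 * d\<^sup>2) * k\<^sup>2" by (rule mult_right_mono) simp
    also have "\<dots> = 4 * n\<^sup>2 * (d * k)\<^sup>2" by (simp add: power_mult_distrib)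
    also have "\<dots> \<le> 4 * n\<^sup>2 * (5 * n)\<^sup>2" using dk by (intro mult_left_mono power_mono) auto
    also have "\<dots> = 100 * n ^ 4" by (simp add: power4_eq_xxxx power2_eq_square)
    finally show ?thesis by (simp add: M_def n_def power3_eq_cube power2_eq_square mult.assoc)
  qed
qed

section \<open>Collinear triples\<close>

text \<open>A layer decomposition of the cube, by \<open>(N + 1)^3 - N^3 \<le> 6 (N + 1)^2\<close>.
  The layers start at 2, where the bound on rich lines begins.\<close>

lemma cube_le_sum_squares:
  fixes N :: nat
  assumes "N \<ge> 2"
  shows "N ^ 3 \<le> 6 * (\<Sum>k=2..N. k\<^sup>2)"
  using assms
proof (induction N rule: nat_induct_at_least)
  case base
  then show ?case by simp
next
  case (Suc N)
  have "Suc N ^ 3 \<le> N ^ 3 + 6 * (Suc N)\<^sup>2"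
    by (simp add: power2_eq_square power3_eq_cube algebra_simps)
  then show ?case using Suc by simp
qed

text \<open>Each term satisfies \<open>1 / (n + 1) \<le> ln (n + 1) - ln n\<close>, and these
  differences telescope. Starting at 2 avoids an additive constant.\<close>

lemma sum_inverse_le_ln:
  assumes "n \<ge> 1"
  shows "(\<Sum>k=2..n. 1 / real k) \<le> ln (real n)"
  using assms
proof (induction n rule: nat_induct_at_least)
  case base
  then show ?case by simp
next
  case (Suc n)
  have "ln (real n / real (Suc n)) \<le> real n / real (Suc n) - 1"
    using Suc by (intro ln_le_minus_one) auto
  also have "\<dots> = - (1 / real (Suc n))"
    by (simp add: field_simps)
  finally have "1 / real (Suc n) \<le> ln (real (Suc n)) - ln (real n)"
    using Suc by (simp add: ln_div)
  then show ?case using Suc by simp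
qed

text \<open>Split each cube into layers and exchange the sums: layer \<open>k\<close> then counts
  the \<open>k\<close>-rich lines with weight \<open>k\<^sup>2\<close>, which is at most
  \<open>100 * n ^ 4 / k\<close>. The harmonic sum produces the logarithm.\<close>

lemma sum_cube_line_trace_le:
  assumes "finite A" "card A \<ge> 2"
  shows "real (\<Sum>l\<in>rich_lines A 2. card (line_trace A l) ^ 3)
    \<le> 600 * real (card A) ^ 4 * ln (real (card A))"
proof -
  define n where "n = card A"
  define R where "R = rich_lines A 2"
  have "A \<noteq> {}" using assms by auto
  have "finite R" using finite_rich_lines[OF assms(1) \<open>A \<noteq> {}\<close>] by (simp add: R_def)
  have rich: "{l \<in> R. k \<le> card (line_trace A l)} = rich_lines A k" if "k \<ge> 2" for k
    using that by (auto simp: R_def rich_lines_def)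
  have "(\<Sum>l\<in>R. card (line_trace A l) ^ 3) \<le> (\<Sum>l\<in>R. 6 * (\<Sum>k=2..card (line_trace A l). k\<^sup>2))"
    by (intro sum_mono cube_le_sum_squares) (auto simp: R_def rich_lines_def)
  \<comment> \<open>The inner range is made independent of \<open>l\<close> so that the sums can be
    exchanged.\<close>
  also have "\<dots> = (\<Sum>l\<in>R. 6 * (\<Sum>k=2..n. if k \<le> card (line_trace A l) then k\<^sup>2 else 0))"
    using card_line_trace_le[OF assms(1)]
    by (intro sum.cong refl arg_cong[where f = "(*) 6"] sum.mono_neutral_cong_left)
       (auto simp: n_def intro: order_trans)
  also have "\<dots> = 6 * (\<Sum>k=2..n. \<Sum>l\<in>R. if k \<le> card (line_trace A l) then k\<^sup>2 else 0)"
    by (subst sum.swap) (simp add: sum_distrib_left)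
  also have "\<dots> = 6 * (\<Sum>k=2..n. card (rich_lines A k) * k\<^sup>2)"
    using \<open>finite R\<close> by (auto simp: rich simp flip: sum.inter_filter intro!: sum.cong)
  finally have "real (\<Sum>l\<in>R. card (line_trace A l) ^ 3)
      \<le> real (6 * (\<Sum>k=2..n. card (rich_lines A k) * k\<^sup>2))"
    by (simp only: of_nat_le_iff)
  also have "\<dots> = 6 * (\<Sum>k=2..n. real (card (rich_lines A k)) * (real k)\<^sup>2)"
    by simp
  also have "\<dots> \<le> 6 * (\<Sum>k=2..n. 100 * real n ^ 4 * (1 / real k))"
  proof (intro mult_left_mono sum_mono)
    fix k assume k: "k \<in> {2..n}"
    have "real (card (rich_lines A k) * k ^ 3) \<le> real (100 * n ^ 4)"
      unfolding of_nat_le_iff n_def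
      by (rule card_rich_lines_le) (use k assms in \<open>auto simp: n_def\<close>)
    then show "real (card (rich_lines A k)) * (real k)\<^sup>2 \<le> 100 * real n ^ 4 * (1 / real k)"
      using k by (simp add: field_simps power2_eq_square power3_eq_cube)
  qed simp
  also have "\<dots> = 600 * real n ^ 4 * (\<Sum>k=2..n. 1 / real k)"
    by (simp add: sum_distrib_left)
  also have "\<dots> \<le> 600 * real n ^ 4 * ln (real n)"
    using assms by (intro mult_left_mono sum_inverse_le_ln) (auto simp: n_def)
  finally show ?thesis by (simp add: R_def n_def)
qed

section \<open>Multiplicative energy of shifted sets\<close>

definition punctured_grid :: "real set \<Rightarrow> real \<times> real \<Rightarrow> (real \<times> real) set" where
  "punctured_grid A p = (A - {fst p}) \<times> (A - {snd p})"

definition shifted_product :: "real \<times> real \<Rightarrow> real \<times> real \<Rightarrow> real" where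
  "shifted_product p z = (fst z - fst p) * (snd z - snd p)"

definition energy_set :: "real set \<Rightarrow> real \<times> real \<Rightarrow> ((real \<times> real) \<times> (real \<times> real)) set" where
  "energy_set A p = {(z, w) \<in> punctured_grid A p \<times> punctured_grid A p.
     shifted_product p z = shifted_product p w}"

lemma finite_punctured_grid: "finite A \<Longrightarrow> finite (punctured_grid A p)"
  by (simp add: punctured_grid_def)

lemma finite_energy_set: "finite A \<Longrightarrow> finite (energy_set A p)"
  unfolding energy_set_def
  by (rule finite_subset[of _ "punctured_grid A p \<times> punctured_grid A p"])
     (auto simp: finite_punctured_grid)

lemma collinear_of_shifted_products_eq:
  fixes a a' x y x' y' :: real
  assumes "(x - a) * (y - a') = (x' - a) * (y' - a')" "x \<noteq> a"
  defines "s \<equiv> (y' - a') / (x - a)"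
  shows "s * x + (a' - s * a) = y'" and "s * x' + (a' - s * a) = y"
proof -
  have "s * (x - a) = y' - a'" using assms(2) by (simp add: s_def)
  then show "s * x + (a' - s * a) = y'" by (simp add: algebra_simps)
  have "s * (x' - a) = y - a'" using assms(1,2) by (simp add: s_def field_simps)
  then show "s * x' + (a' - s * a) = y" by (simp add: algebra_simps)
qed

text \<open>A solution of the energy equation is encoded by its line and the abscissae of three
  points on it. The encoding is injective, and a line carries
  \<open>card (line_trace A l) ^ 3\<close> triples.\<close>

lemma sum_card_energy_set_le:
  assumes "finite A" "A \<noteq> {}"
  shows "(\<Sum>p\<in>A \<times> A. card (energy_set A p))
    \<le> (\<Sum>l\<in>rich_lines A 2. card (line_trace A l) ^ 3)"
proof -
  define U where "U = Sigma (rich_lines A 2)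
    (\<lambda>l. line_trace A l \<times> line_trace A l \<times> line_trace A l)"
  define \<phi> :: "(real \<times> real) \<times> (real \<times> real) \<times> (real \<times> real) \<Rightarrow>
      (real \<times> real) \<times> real \<times> real \<times> real" where
    "\<phi> = (\<lambda>((a, a'), (x, y), (x', y')).
       let s = (y' - a') / (x - a) in ((s, a' - s * a), a, x, x'))"
  \<comment> \<open>Left inverse of \<open>\<phi>\<close>. The ordinates are crossed:
    \<open>y\<close> is the height of the line over \<open>x'\<close>, and \<open>y'\<close> its
    height over \<open>x\<close>.\<close>
  define \<psi> :: "(real \<times> real) \<times> real \<times> real \<times> real \<Rightarrow>
      (real \<times> real) \<times> (real \<times> real) \<times> (real \<times> real)" where
    "\<psi> = (\<lambda>((s, b), a, x, x'). ((a, s * a + b), (x, s * x' + b), (x', s * x + b)))"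
  have "(\<Sum>p\<in>A \<times> A. card (energy_set A p)) = card (Sigma (A \<times> A) (energy_set A))"
    using assms finite_energy_set by (subst card_SigmaI) auto
  also have "\<dots> \<le> card U"
  proof (rule card_inj_on_le)
    show "inj_on \<phi> (Sigma (A \<times> A) (energy_set A))"
    proof (rule inj_on_inverseI[of _ \<psi>])
      fix t assume "t \<in> Sigma (A \<times> A) (energy_set A)"
      then obtain a a' x y x' y' where t: "t = ((a, a'), (x, y), (x', y'))"
        "(x - a) * (y - a') = (x' - a) * (y' - a')" "x \<noteq> a"
        by (auto simp: energy_set_def punctured_grid_def shifted_product_def)
      then show "\<psi> (\<phi> t) = t"
        using collinear_of_shifted_products_eq[OF t(2,3)] by (simp add: \<phi>_def \<psi>_def Let_def)
    qed
    show "\<phi> ` Sigma (A \<times> A) (energy_set A) \<subseteq> U"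
    proof (rule image_subsetI)
      fix t assume "t \<in> Sigma (A \<times> A) (energy_set A)"
      then obtain a a' x y x' y' where t: "t = ((a, a'), (x, y), (x', y'))"
        "(x - a) * (y - a') = (x' - a) * (y' - a')" "x \<noteq> a" "y' \<noteq> a'"
        and A: "a \<in> A" "a' \<in> A" "x \<in> A" "y \<in> A" "x' \<in> A" "y' \<in> A"
        by (auto simp: energy_set_def punctured_grid_def shifted_product_def)
      define s where "s = (y' - a') / (x - a)"
      define l where "l = (s, a' - s * a)"
      have \<phi>: "\<phi> t = (l, a, x, x')" by (simp add: t \<phi>_def l_def s_def Let_def)
      have tr: "a \<in> line_trace A l" "x \<in> line_trace A l" "x' \<in> line_trace A l"
        using A collinear_of_shifted_products_eq[OF t(2,3)]
        by (auto simp: line_trace_def l_def s_def)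
      \<comment> \<open>Puncturing the grid pays off here: \<open>x \<noteq> a\<close> gives two
        distinct points on the line, and \<open>y' \<noteq> a'\<close> makes its slope
        nonzero.\<close>
      have "card {a, x} \<le> card (line_trace A l)"
        using tr finite_line_trace[OF assms(1)] by (intro card_mono) auto
      moreover have "s \<noteq> 0" using t by (simp add: s_def)
      ultimately have "l \<in> rich_lines A 2" using t(3) by (simp add: rich_lines_def l_def)
      then show "\<phi> t \<in> U" using tr by (simp add: \<phi> U_def)
    qed
    show "finite U"
      using finite_rich_lines[OF assms] finite_line_trace[OF assms(1)] by (auto simp: U_def)
  qed
  also have "card U = (\<Sum>l\<in>rich_lines A 2. card (line_trace A l) ^ 3)"
    using finite_rich_lines[OF assms] finite_line_trace[OF assms(1)]
    by (simp add: U_def card_SigmaI card_cartesian_product power3_eq_cube mult.assoc)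
  finally show ?thesis .
qed

text \<open>Averaging: the energies over the \<open>(card A)\<^sup>2\<close> shifts \<open>p\<close>
  sum to at most \<open>600 * n ^ 4 * ln n\<close> with \<open>n = card A\<close>, so some shift is
  at most the mean.\<close>

lemma exists_small_energy:
  assumes "finite A" "card A \<ge> 2"
  obtains p where "p \<in> A \<times> A"
    "real (card (energy_set A p)) \<le> 600 * (real (card A))\<^sup>2 * ln (real (card A))"
proof -
  define B where "B = 600 * (real (card A))\<^sup>2 * ln (real (card A))"
  have "A \<noteq> {}" using assms by auto
  have "\<exists>p\<in>A \<times> A. real (card (energy_set A p)) \<le> B"
  proof (rule ccontr)
    assume "\<not> ?thesis"
    then have "(\<Sum>p\<in>A \<times> A. B) < (\<Sum>p\<in>A \<times> A. real (card (energy_set A p)))"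
      using assms(1) \<open>A \<noteq> {}\<close> by (intro sum_strict_mono) (auto simp: not_le)
    also have "\<dots> = real (\<Sum>p\<in>A \<times> A. card (energy_set A p))" by simp
    also have "\<dots> \<le> real (\<Sum>l\<in>rich_lines A 2. card (line_trace A l) ^ 3)"
      unfolding of_nat_le_iff by (rule sum_card_energy_set_le) fact+
    also have "\<dots> \<le> 600 * real (card A) ^ 4 * ln (real (card A))"
      by (rule sum_cube_line_trace_le) fact+
    also have "\<dots> = (\<Sum>p\<in>A \<times> A. B)"
      by (simp add: B_def card_cartesian_product power4_eq_xxxx power2_eq_square)
    finally show False by simp
  qed
  then show thesis using that by (auto simp: B_def)
qed

section \<open>From small energy to a large product set\<close>

theorem theorem1p1:
  "\<exists>c::real. c > 0 \<and>
    (\<forall>A::real set. finite A \<and> card A \<ge> 2 \<longrightarrow>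
      (\<exists>a\<in>A. \<exists>a'\<in>A.
        real (card (shifted_product_set A a a')) \<ge> c * ((real (card A))\<^sup>2 / ln (real (card A)))))"
proof (intro exI[of _ "1 / 9600"] conjI allI impI)
  fix A :: "real set"
  assume A: "finite A \<and> card A \<ge> 2"
  define n where "n = real (card A)"
  have n: "n \<ge> 2" using A by (simp add: n_def)
  obtain a a' where a: "a \<in> A" "a' \<in> A"
    and E: "real (card (energy_set A (a, a'))) \<le> 600 * n\<^sup>2 * ln n"
    using exists_small_energy[of A] A unfolding n_def by (metis mem_Sigma_iff surj_pair)
  define P where "P = real (card (shifted_product_set A a a'))"
  have sub: "shifted_product (a, a') ` punctured_grid A (a, a') \<subseteq> shifted_product_set A a a'"
    by (auto simp: shifted_product_def punctured_grid_def shifted_product_set_def)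
  have "shifted_product_set A a a' = (\<lambda>(x, y). (x - a) * (y - a')) ` (A \<times> A)"
    by (auto simp: shifted_product_set_def)
  then have "finite (shifted_product_set A a a')" using A by simp
  then have "card (shifted_product (a, a') ` punctured_grid A (a, a'))
      \<le> card (shifted_product_set A a a')"
    using sub by (rule card_mono)
  then have image: "real (card (shifted_product (a, a') ` punctured_grid A (a, a'))) \<le> P"
    by (simp add: P_def)
  have "real (card (punctured_grid A (a, a'))) = (n - 1)\<^sup>2"
    using A a by (simp add: punctured_grid_def card_cartesian_product n_def of_nat_diff power2_eq_square)
  \<comment> \<open>Replacing \<open>n - 1\<close> by \<open>n / 2\<close> costs a factor 16 in the
    fourth power, whence the constant \<open>9600 = 16 * 600\<close>.\<close>
  moreover have "(n / 2)\<^sup>2 \<le> (n - 1)\<^sup>2" using n by (intro power_mono) auto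
  ultimately have "((n / 2)\<^sup>2)\<^sup>2 \<le> real ((card (punctured_grid A (a, a')))\<^sup>2)"
    unfolding of_nat_power by (metis power_mono zero_le_power2)
  also have "\<dots> \<le> real (card (shifted_product (a, a') ` punctured_grid A (a, a'))
      * card (energy_set A (a, a')))"
    unfolding of_nat_le_iff energy_set_def
    by (rule card_power2_le_card_image_times_energy) (simp add: A finite_punctured_grid)
  also have "\<dots> \<le> P * (600 * n\<^sup>2 * ln n)"
    unfolding of_nat_mult using image E by (intro mult_mono) (auto simp: P_def)
  finally have "n\<^sup>2 * n\<^sup>2 \<le> n\<^sup>2 * (9600 * (P * ln n))"
    by (simp add: power_divide algebra_simps flip: power_mult power_add)
  then have "n\<^sup>2 \<le> 9600 * (P * ln n)"
    by (rule mult_left_le_imp_le) (use n in simp)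
  then have "1 / 9600 * (n\<^sup>2 / ln n) \<le> P" using n by (simp add: field_simps)
  then show "\<exists>a\<in>A. \<exists>a'\<in>A. real (card (shifted_product_set A a a'))
      \<ge> 1 / 9600 * ((real (card A))\<^sup>2 / ln (real (card A)))"
    using a unfolding P_def n_def by blast
qed simp

end
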